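(* Let $n\ge2$, $\alpha\in\left(\frac{-1}{n-1},1\right)$, and let $(\lambda,x)$ be a (possibly complex) eigenpair of an equiangular matrix $S\in EM^n_\alpha$ with $\Vert x\Vert=1$. Then $$\lambda_{\min}(\bar S_\alpha)\le|\lambda|\le\lambda_{\max}(\bar S_\alpha),$$ where $\lambda_{\min}(\bar S_\alpha)$ and $\lambda_{\max}(\bar S_\alpha)$ are the minimum and maximum eigenvalues of $\bar S_\alpha$.
   Context: $EM^n_\alpha$ denotes the set of nonsingular real $n\times n$ matrices $S=[s_1,\dots,s_n]$ whose columns satisfy $s_i^Ts_i=1$ and $s_i^Ts_j=\alpha$ for $i\ne j$. $G_\alpha$ is the $n\times n$ matrix with ones on the diagonal and $\alpha$ in all off-diagonal positions (it is positive definite for this range of $\alpha$), and $\bar S_\alpha=G_\alpha^{1/2}$ is its unique symmetric positive definite (principal) square root. *)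

theory Defs
  imports "Jordan_Normal_Form.Spectral_Radius" "HOL-Analysis.L2_Norm"
begin

text \<open>The columns \<open>s\<^sub>1, \<dots>, s\<^sub>n\<close> are indexed from 0.\<close>

definition equiangular_mats :: "nat \<Rightarrow> real \<Rightarrow> real mat set" where
  "equiangular_mats n \<alpha> = {S \<in> carrier_mat n n. invertible_mat S
     \<and> (\<forall>i<n. col S i \<bullet> col S i = 1)
     \<and> (\<forall>i<n. \<forall>j<n. i \<noteq> j \<longrightarrow> col S i \<bullet> col S j = \<alpha>)}"

definition equiangular_gram :: "nat \<Rightarrow> real \<Rightarrow> real mat" where
  "equiangular_gram n \<alpha> = mat n n (\<lambda>(i, j). if i = j then 1 else \<alpha>)"

definition sym_pos_def :: "real mat \<Rightarrow> bool" where
  "sym_pos_def A \<longleftrightarrow> square_mat A \<and> transpose_mat A = A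
     \<and> (\<forall>x \<in> carrier_vec (dim_row A). x \<noteq> 0\<^sub>v (dim_row A) \<longrightarrow> 0 < x \<bullet> (A *\<^sub>v x))"

text \<open>Only meaningful when \<open>G\<close> is symmetric positive definite; the description then has exactly
  one witness.\<close>

definition principal_sqrt_mat :: "real mat \<Rightarrow> real mat" where
  "principal_sqrt_mat G = (THE P. P \<in> carrier_mat (dim_row G) (dim_col G) \<and> sym_pos_def P \<and> P * P = G)"

definition equiangular_sqrt :: "nat \<Rightarrow> real \<Rightarrow> real mat" where
  "equiangular_sqrt n \<alpha> = principal_sqrt_mat (equiangular_gram n \<alpha>)"

text \<open>The spectrum is that of the matrix over the reals, so these are the extreme eigenvalues for
  nonempty matrices whose eigenvalues are all real, in particular for symmetric ones.\<close>

definition min_eigenvalue :: "real mat \<Rightarrow> real" where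
  "min_eigenvalue A = Min (spectrum A)"

definition max_eigenvalue :: "real mat \<Rightarrow> real" where
  "max_eigenvalue A = Max (spectrum A)"

definition euclidean_norm_vec :: "complex vec \<Rightarrow> real" where
  "euclidean_norm_vec x = L2_set (\<lambda>i. cmod (x $ i)) {0..<dim_vec x}"

end

theory Submission
  imports Defs
begin

text \<open>Since \<open>S\<^sup>T S = G\<^sub>\<alpha>\<close>, a unit eigenvector satisfies
  \<open>|\<lambda>|\<^sup>2 = x\<^sup>* G\<^sub>\<alpha> x = (1 - \<alpha>) + \<alpha> |\<Sum>\<^sub>i x\<^sub>i|\<^sup>2\<close>, and \<open>|\<Sum>\<^sub>i x\<^sub>i|\<^sup>2 \<le> n\<close> by Cauchy-Schwarz, so \<open>|\<lambda>|\<^sup>2\<close>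
  lies between \<open>1 - \<alpha>\<close> and \<open>1 + (n - 1) \<alpha>\<close>. The square root of \<open>G\<^sub>\<alpha>\<close> is explicit: it is \<open>a I + b J\<close>
  with \<open>J\<close> the all-ones matrix, \<open>a\<^sup>2 = 1 - \<alpha>\<close> and \<open>(a + n b)\<^sup>2 = 1 + (n - 1) \<alpha>\<close>, and its
  eigenvalues are \<open>a\<close> and \<open>a + n b\<close>.\<close>

section \<open>Algebra and positivity of the matrices \<open>a I + b J\<close>\<close>

definition scalar_plus_ones :: "nat \<Rightarrow> real \<Rightarrow> real \<Rightarrow> real mat" where
  "scalar_plus_ones n a b = mat n n (\<lambda>(i, j). (if i = j then a else 0) + b)"

lemma scalar_plus_ones_carrier [simp]: "scalar_plus_ones n a b \<in> carrier_mat n n"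
  by (simp add: scalar_plus_ones_def)

lemma scalar_plus_ones_dim [simp]:
  "dim_row (scalar_plus_ones n a b) = n" "dim_col (scalar_plus_ones n a b) = n"
  by (simp_all add: scalar_plus_ones_def)

lemma equiangular_gram_eq: "equiangular_gram n \<alpha> = scalar_plus_ones n (1 - \<alpha>) \<alpha>"
  by (rule eq_matI) (auto simp: equiangular_gram_def scalar_plus_ones_def)

lemma scalar_plus_ones_mult_vec:
  assumes "v \<in> carrier_vec n" "i < n"
  shows "(scalar_plus_ones n a b *\<^sub>v v) $ i = a * v $ i + b * (\<Sum>j<n. v $ j)"
proof -
  have "(scalar_plus_ones n a b *\<^sub>v v) $ i
      = (\<Sum>j<n. ((if i = j then a else 0) + b) * v $ j)"
    using assms by (simp add: scalar_plus_ones_def scalar_prod_def lessThan_atLeast0)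
  also have "\<dots> = (\<Sum>j<n. (if i = j then a * v $ j else 0)) + b * (\<Sum>j<n. v $ j)"
    unfolding sum_distrib_left sum.distrib[symmetric]
    by (rule sum.cong) (auto simp: algebra_simps)
  also have "\<dots> = a * v $ i + b * (\<Sum>j<n. v $ j)"
    using assms by simp
  finally show ?thesis .
qed

text \<open>Because \<open>J * J = n J\<close>, the span of \<open>I\<close> and \<open>J\<close> is
  closed under products. Finding a square root of the Gram matrix thereby reduces to two scalar
  equations.\<close>

lemma scalar_plus_ones_mult:
  "scalar_plus_ones n a b * scalar_plus_ones n c d
    = scalar_plus_ones n (a * c) (a * d + b * c + real n * b * d)" (is "?L = ?R")
proof (rule eq_matI)
  fix i j assume ij: "i < dim_row ?R" "j < dim_col ?R"
  let ?v = "col (scalar_plus_ones n c d) j"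
  have "?L $$ (i, j) = (scalar_plus_ones n a b *\<^sub>v ?v) $ i"
    using ij by simp
  also have "\<dots> = a * ?v $ i + b * (\<Sum>k<n. ?v $ k)"
    by (rule scalar_plus_ones_mult_vec) (use ij in \<open>auto intro: carrier_vecI\<close>)
  also have "(\<Sum>k<n. ?v $ k) = (\<Sum>k<n. (if k = j then c else 0) + d)"
    using ij by (intro sum.cong) (auto simp: scalar_plus_ones_def)
  also have "\<dots> = c + real n * d"
    using ij by (simp add: sum.distrib)
  finally show "?L $$ (i, j) = ?R $$ (i, j)"
    using ij by (auto simp: scalar_plus_ones_def algebra_simps)
qed simp_all

lemma transpose_scalar_plus_ones: "transpose_mat (scalar_plus_ones n a b) = scalar_plus_ones n a b"
  by (rule eq_matI) (auto simp: scalar_plus_ones_def)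

lemma scalar_plus_ones_quadratic_form:
  assumes "v \<in> carrier_vec n"
  shows "v \<bullet> (scalar_plus_ones n a b *\<^sub>v v) = a * (\<Sum>i<n. (v $ i)\<^sup>2) + b * (\<Sum>i<n. v $ i)\<^sup>2"
proof -
  have "v \<bullet> (scalar_plus_ones n a b *\<^sub>v v) = (\<Sum>i<n. v $ i * (scalar_plus_ones n a b *\<^sub>v v) $ i)"
    by (simp add: scalar_prod_def lessThan_atLeast0 del: index_mult_mat_vec)
  also have "\<dots> = (\<Sum>i<n. a * (v $ i)\<^sup>2 + b * (\<Sum>j<n. v $ j) * v $ i)"
    by (rule sum.cong)
       (simp_all add: scalar_plus_ones_mult_vec[OF assms] power2_eq_square algebra_simps
         del: index_mult_mat_vec)
  also have "\<dots> = a * (\<Sum>i<n. (v $ i)\<^sup>2) + b * (\<Sum>i<n. v $ i)\<^sup>2"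
    by (simp add: sum.distrib sum_distrib_left[symmetric] power2_eq_square)
  finally show ?thesis .
qed

text \<open>Cauchy-Schwarz against the constant function 1. It controls the \<open>J\<close> term
  both in the positivity proof and in the final eigenvalue estimate.\<close>

lemma power2_sum_le_card_mult_sum_power2:
  fixes f :: "'a \<Rightarrow> real"
  shows "(\<Sum>i\<in>A. f i)\<^sup>2 \<le> real (card A) * (\<Sum>i\<in>A. (f i)\<^sup>2)"
proof -
  have "\<bar>\<Sum>i\<in>A. f i\<bar> \<le> (\<Sum>i\<in>A. \<bar>f i\<bar> * \<bar>1\<bar>)"
    by simp
  also have "\<dots> \<le> L2_set f A * L2_set (\<lambda>_. 1) A"
    by (rule L2_set_mult_ineq)
  finally have "(\<Sum>i\<in>A. f i)\<^sup>2 \<le> (L2_set f A * L2_set (\<lambda>_. 1) A)\<^sup>2"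
    by (simp add: abs_le_square_iff[symmetric] L2_set_nonneg)
  then show ?thesis
    by (simp add: L2_set_def power_mult_distrib sum_nonneg mult.commute)
qed

text \<open>With \<open>p\<close> the sum of squares and \<open>q\<close> the square of the sum, the
  form is \<open>a * p + b * q\<close> where \<open>0 \<le> q \<le> n * p\<close>. It is affine in
  \<open>q\<close>, hence at least the smaller of its endpoint values \<open>a * p\<close> and
  \<open>(a + n * b) * p\<close>.\<close>

lemma scalar_plus_ones_sym_pos_def:
  assumes "a > 0" "a + real n * b > 0"
  shows "sym_pos_def (scalar_plus_ones n a b)"
  unfolding sym_pos_def_def
proof (intro conjI ballI impI)
  fix v :: "real vec"
  assume "v \<in> carrier_vec (dim_row (scalar_plus_ones n a b))"
    and "v \<noteq> 0\<^sub>v (dim_row (scalar_plus_ones n a b))"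
  then have v: "v \<in> carrier_vec n" and nz: "v \<noteq> 0\<^sub>v n"
    by simp_all
  define p q where "p = (\<Sum>i<n. (v $ i)\<^sup>2)" and "q = (\<Sum>i<n. v $ i)\<^sup>2"
  obtain i where i: "i < n" "v $ i \<noteq> 0"
    using v nz by (metis carrier_vecD eq_vecI index_zero_vec)
  have "p > 0"
    unfolding p_def using i by (intro sum_pos2[of _ i]) auto
  have "q \<ge> 0" "q \<le> real n * p"
    using power2_sum_le_card_mult_sum_power2[of "\<lambda>i. v $ i" "{..<n}"] by (simp_all add: p_def q_def)
  have "a * p + b * q > 0"
  proof (cases "b \<ge> 0")
    case True
    then show ?thesis
      using \<open>p > 0\<close> \<open>q \<ge> 0\<close> assms by (simp add: add_pos_nonneg)
  next
    case False
    then have "b * q \<ge> b * (real n * p)"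
      using \<open>q \<le> real n * p\<close> by (simp add: mult_left_mono_neg)
    moreover have "(a + real n * b) * p > 0"
      using assms \<open>p > 0\<close> by simp
    ultimately show ?thesis
      by (simp add: algebra_simps)
  qed
  then show "v \<bullet> (scalar_plus_ones n a b *\<^sub>v v) > 0"
    by (simp add: scalar_plus_ones_quadratic_form[OF v] p_def q_def)
qed (simp_all add: transpose_scalar_plus_ones)

section \<open>Uniqueness of the positive definite square root\<close>

lemma sum_diag_mult_commute:
  fixes A B :: "'a :: comm_semiring_0 mat"
  assumes "A \<in> carrier_mat n m" "B \<in> carrier_mat m n"
  shows "(\<Sum>i<n. (A * B) $$ (i, i)) = (\<Sum>i<m. (B * A) $$ (i, i))"
proof -
  have "(\<Sum>i<n. (A * B) $$ (i, i)) = (\<Sum>i<n. \<Sum>k<m. A $$ (i, k) * B $$ (k, i))"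
    using assms by (intro sum.cong) (auto simp: scalar_prod_def lessThan_atLeast0)
  also have "\<dots> = (\<Sum>k<m. \<Sum>i<n. B $$ (k, i) * A $$ (i, k))"
    by (subst sum.swap) (simp add: mult.commute)
  also have "\<dots> = (\<Sum>k<m. (B * A) $$ (k, k))"
    using assms by (intro sum.cong) (auto simp: scalar_prod_def lessThan_atLeast0)
  finally show ?thesis .
qed

text \<open>Symmetry makes each row of \<open>D\<close> equal to the corresponding column. The trace
  of \<open>D A D\<close> thus becomes a sum of values of the form of \<open>A\<close>, all
  nonnegative when \<open>A\<close> is positive definite.\<close>

lemma diag_congruence:
  fixes A D :: "'a :: comm_semiring_0 mat"
  assumes "A \<in> carrier_mat n n" "D \<in> carrier_mat n n" "transpose_mat D = D" "i < n"
  shows "(D * (A * D)) $$ (i, i) = col D i \<bullet> (A *\<^sub>v col D i)"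
proof -
  have "row D i = col D i"
    using assms by (metis carrier_matD(1) row_transpose carrier_matD(2))
  moreover have "col (A * D) i = A *\<^sub>v col D i"
    using assms by (intro eq_vecI) auto
  ultimately show ?thesis
    using assms by simp
qed

lemma sym_pos_def_nonneg:
  assumes "sym_pos_def A" "A \<in> carrier_mat n n" "v \<in> carrier_vec n"
  shows "0 \<le> v \<bullet> (A *\<^sub>v v)"
proof (cases "v = 0\<^sub>v n")
  case False
  then show ?thesis
    using assms by (auto simp: sym_pos_def_def intro!: less_imp_le)
qed (use assms in \<open>simp add: scalar_prod_def\<close>)

text \<open>With \<open>D = P - Q\<close> the hypothesis says \<open>P D + D Q = 0\<close>, hence \<open>tr (D P D) + tr (D Q D) = 0\<close>, where
  both traces are sums of values of positive definite forms at the columns of \<open>D\<close>.\<close>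

lemma sym_pos_def_sqrt_unique:
  assumes P: "P \<in> carrier_mat n n" "sym_pos_def P"
    and Q: "Q \<in> carrier_mat n n" "sym_pos_def Q"
    and eq: "P * P = Q * Q"
  shows "P = Q"
proof -
  define D where "D = P - Q"
  have D: "D \<in> carrier_mat n n"
    unfolding D_def using Q(1) by (rule minus_carrier_mat)
  have sym: "transpose_mat D = D"
    using P Q by (simp add: D_def sym_pos_def_def transpose_minus)
  \<comment> \<open>\<open>P\<close> and \<open>Q\<close> are not known to commute; with
    \<open>P\<close> on the left and \<open>Q\<close> on the right, the mixed terms
    \<open>P * Q\<close> cancel.\<close>
  have "P * D + D * Q = (P * P - P * Q) + (P * Q - Q * Q)"
    unfolding D_def
    using P(1) Q(1) by (simp add: mult_minus_distrib_mat minus_mult_distrib_mat)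
  also have "\<dots> = 0\<^sub>m n n"
    unfolding eq using P(1) Q(1) by (intro eq_matI) auto
  finally have sylvester: "P * D + D * Q = 0\<^sub>m n n" .
  have "D * (P * D) + D * (D * Q) = D * (P * D + D * Q)"
    using P(1) Q(1) D by (intro mult_add_distrib_mat[symmetric]) auto
  then have sum0: "D * (P * D) + D * (D * Q) = 0\<^sub>m n n"
    using D by (simp add: sylvester)
  have "0 = (\<Sum>i<n. (D * (P * D) + D * (D * Q)) $$ (i, i))"
    unfolding sum0 by simp
  also have "\<dots> = (\<Sum>i<n. (D * (P * D)) $$ (i, i) + (D * (D * Q)) $$ (i, i))"
    using P(1) Q(1) D by (intro sum.cong) auto
  also have "\<dots> = (\<Sum>i<n. (D * (P * D)) $$ (i, i)) + (\<Sum>i<n. (D * (D * Q)) $$ (i, i))"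
    by (rule sum.distrib)
  \<comment> \<open>Cyclicity of the trace brings the second term to the shape \<open>D A D\<close>
    required by \<open>diag_congruence\<close>.\<close>
  also have "(\<Sum>i<n. (D * (D * Q)) $$ (i, i)) = (\<Sum>i<n. ((D * Q) * D) $$ (i, i))"
    by (rule sum_diag_mult_commute) (use D Q in auto)
  also have "(D * Q) * D = D * (Q * D)"
    using D Q by (simp add: assoc_mult_mat)
  finally have zero: "(\<Sum>i<n. col D i \<bullet> (P *\<^sub>v col D i)) + (\<Sum>i<n. col D i \<bullet> (Q *\<^sub>v col D i)) = 0"
    using P(1) Q(1) D sym by (simp add: diag_congruence del: index_mult_mat)
  have cols: "col D i \<in> carrier_vec n" for i
    using D by auto
  have "(\<Sum>i<n. col D i \<bullet> (Q *\<^sub>v col D i)) \<ge> 0"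
    using cols by (intro sum_nonneg sym_pos_def_nonneg[OF Q(2,1)])
  moreover have "(\<Sum>i<n. col D i \<bullet> (P *\<^sub>v col D i)) \<ge> 0"
    using cols by (intro sum_nonneg sym_pos_def_nonneg[OF P(2,1)])
  ultimately have "(\<Sum>i<n. col D i \<bullet> (P *\<^sub>v col D i)) = 0"
    using zero by linarith
  \<comment> \<open>A vanishing sum of nonnegative terms has only zero terms; definiteness of
    \<open>P\<close> then kills every column of \<open>D\<close>.\<close>
  then have "col D i \<bullet> (P *\<^sub>v col D i) = 0" if "i < n" for i
    using that cols sym_pos_def_nonneg[OF P(2,1)] by (subst (asm) sum_nonneg_eq_0_iff) auto
  then have col0: "col D i = 0\<^sub>v n" if "i < n" for i
    using that P cols[of i] by (fastforce simp: sym_pos_def_def)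
  show "P = Q"
  proof (rule eq_matI)
    fix i j assume "i < dim_row Q" "j < dim_col Q"
    then have "D $$ (i, j) = col D j $ i" "i < n" "j < n"
      using D Q by auto
    then have "D $$ (i, j) = 0"
      by (simp add: col0)
    then show "P $$ (i, j) = Q $$ (i, j)"
      using P Q \<open>i < n\<close> \<open>j < n\<close> by (simp add: D_def)
  qed (use P Q in auto)
qed

text \<open>By uniqueness, exhibiting one positive definite root evaluates the definite
  description.\<close>

lemma principal_sqrt_mat_eq:
  assumes "P \<in> carrier_mat n n" "sym_pos_def P"
  shows "principal_sqrt_mat (P * P) = P"
  unfolding principal_sqrt_mat_def
proof (rule the_equality)
  fix Q assume "Q \<in> carrier_mat (dim_row (P * P)) (dim_col (P * P)) \<and> sym_pos_def Q \<and> Q * Q = P * P"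
  then show "Q = P"
    using assms by (intro sym_pos_def_sqrt_unique[of Q n P]) auto
qed (use assms in auto)

section \<open>Spectra of \<open>a I + b J\<close> and of the root of the Gram matrix\<close>

lemma spectrum_scalar_plus_ones:
  assumes "n \<ge> 2"
  shows "spectrum (scalar_plus_ones n a b) = {a, a + real n * b}"
proof (intro equalityI subsetI)
  fix k assume "k \<in> spectrum (scalar_plus_ones n a b)"
  then obtain v where v: "v \<in> carrier_vec n" "v \<noteq> 0\<^sub>v n"
    and ev: "scalar_plus_ones n a b *\<^sub>v v = k \<cdot>\<^sub>v v"
    by (auto simp: spectrum_def eigenvalue_def eigenvector_def)
  define s where "s = (\<Sum>j<n. v $ j)"
  have comp: "k * v $ i = a * v $ i + b * s" if "i < n" for i
    using scalar_plus_ones_mult_vec[OF v(1) that, of a b] v(1) that by (simp add: ev s_def)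
  \<comment> \<open>Summing the coordinate equations gives an equation in the coordinate sum
    \<open>s\<close> only.\<close>
  have "k * s = (\<Sum>i<n. k * v $ i)"
    by (simp add: s_def sum_distrib_left)
  also have "\<dots> = (\<Sum>i<n. a * v $ i + b * s)"
    using comp by (intro sum.cong) auto
  also have "\<dots> = (a + real n * b) * s"
    by (simp add: sum.distrib sum_distrib_left[symmetric] distrib_right flip: s_def)
  finally have ks: "k * s = (a + real n * b) * s" .
  obtain i where i: "i < n" "v $ i \<noteq> 0"
    using v by (metis carrier_vecD eq_vecI index_zero_vec)
  \<comment> \<open>If \<open>s\<close> is nonzero it cancels in \<open>ks\<close>; if
    \<open>s = 0\<close>, a coordinate with \<open>v $ i\<close> nonzero yields
    \<open>k = a\<close>.\<close>
  show "k \<in> {a, a + real n * b}"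
    using ks comp[OF i(1)] i by (cases "s = 0") auto
next
  fix k assume "k \<in> {a, a + real n * b}"
  then consider "k = a" | "k = a + real n * b"
    by auto
  then have "\<exists>v. eigenvector (scalar_plus_ones n a b) v k"
  proof cases
    case 1
    \<comment> \<open>The difference of the first two unit vectors has coordinate sum 0, so
      \<open>J\<close> annihilates it; this is where \<open>n \<ge> 2\<close> matters.\<close>
    define v :: "real vec" where "v = vec n (\<lambda>i. (if i = 0 then 1 else 0) - (if i = 1 then 1 else 0))"
    have v: "v \<in> carrier_vec n"
      by (simp add: v_def)
    have "(\<Sum>j<n. v $ j) = (\<Sum>j<n. (if j = 0 then 1 else 0) - (if j = 1 then 1 else 0))"
      by (intro sum.cong) (auto simp: v_def)
    also have "\<dots> = 0"
      using assms by (simp add: sum_subtractf)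
    finally have "scalar_plus_ones n a b *\<^sub>v v = a \<cdot>\<^sub>v v"
      using v by (intro eq_vecI) (simp_all add: scalar_plus_ones_mult_vec del: index_mult_mat_vec)
    moreover have "v $ 0 \<noteq> 0\<^sub>v n $ 0"
      using assms by (simp add: v_def)
    ultimately have "eigenvector (scalar_plus_ones n a b) v k"
      using v 1 by (auto simp: eigenvector_def)
    then show ?thesis ..
  next
    case 2
    define v :: "real vec" where "v = vec n (\<lambda>_. 1)"
    have v: "v \<in> carrier_vec n"
      by (simp add: v_def)
    have "(\<Sum>j<n. v $ j) = real n"
      by (simp add: v_def)
    then have "scalar_plus_ones n a b *\<^sub>v v = k \<cdot>\<^sub>v v"
      using v 2 by (intro eq_vecI)
        (simp_all add: scalar_plus_ones_mult_vec v_def del: index_mult_mat_vec)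
    moreover have "v $ 0 \<noteq> 0\<^sub>v n $ 0"
      using assms by (simp add: v_def)
    ultimately have "eigenvector (scalar_plus_ones n a b) v k"
      using v by (auto simp: eigenvector_def)
    then show ?thesis ..
  qed
  then show "k \<in> spectrum (scalar_plus_ones n a b)"
    by (simp add: spectrum_def eigenvalue_def)
qed

lemma spectrum_equiangular_sqrt:
  assumes "n \<ge> 2" "1 - \<alpha> > 0" "1 - \<alpha> + real n * \<alpha> > 0"
  shows "spectrum (equiangular_sqrt n \<alpha>) = {sqrt (1 - \<alpha>), sqrt (1 - \<alpha> + real n * \<alpha>)}"
proof -
  \<comment> \<open>The squares of \<open>a\<close> and \<open>c\<close> are the eigenvalues of the
    Gram matrix on sum-zero vectors and on the all-ones vector; \<open>b\<close> is then forced by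
    \<open>a + n b = c\<close>.\<close>
  define a c where "a = sqrt (1 - \<alpha>)" and "c = sqrt (1 - \<alpha> + real n * \<alpha>)"
  define b where "b = (c - a) / real n"
  have nb: "a + real n * b = c"
    using assms by (simp add: b_def)
  have pos: "a > 0" "c > 0"
    using assms by (simp_all add: a_def c_def)
  have a2: "a * a = 1 - \<alpha>" and c2: "c * c = 1 - \<alpha> + real n * \<alpha>"
    using assms by (simp_all add: a_def c_def)
  \<comment> \<open>The parenthesis is the coefficient of \<open>J\<close> in the square of
    \<open>a I + b J\<close>; multiplying by \<open>n\<close> completes the square in
    \<open>a + n b\<close>.\<close>
  have "real n * (a * b + b * a + real n * b * b) = c * c - a * a"
    by (simp add: nb[symmetric] algebra_simps)
  then have "real n * (a * b + b * a + real n * b * b) = real n * \<alpha>"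
    by (simp add: a2 c2)
  then have "a * b + b * a + real n * b * b = \<alpha>"
    using assms(1) by simp
  then have "equiangular_gram n \<alpha> = scalar_plus_ones n a b * scalar_plus_ones n a b"
    by (simp add: equiangular_gram_eq scalar_plus_ones_mult a2)
  then have "equiangular_sqrt n \<alpha> = scalar_plus_ones n a b"
    unfolding equiangular_sqrt_def
    using principal_sqrt_mat_eq[of "scalar_plus_ones n a b" n] pos
    by (simp add: scalar_plus_ones_sym_pos_def nb)
  then show ?thesis
    using spectrum_scalar_plus_ones[OF assms(1), of a b] by (simp add: nb flip: a_def c_def)
qed

section \<open>The length of \<open>S x\<close> and the eigenvalue bounds\<close>

lemma equiangular_mats_sum_cmod_power2:
  assumes S: "S \<in> equiangular_mats n \<alpha>" and x: "x \<in> carrier_vec n"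
  shows "(\<Sum>k<n. (cmod ((map_mat complex_of_real S *\<^sub>v x) $ k))\<^sup>2)
    = (1 - \<alpha>) * (\<Sum>i<n. (cmod (x $ i))\<^sup>2) + \<alpha> * (cmod (\<Sum>i<n. x $ i))\<^sup>2"
proof -
  have Sc: "S \<in> carrier_mat n n"
    using S by (simp add: equiangular_mats_def)
  have gram: "(\<Sum>k<n. S $$ (k, i) * S $$ (k, j)) = (if i = j then 1 - \<alpha> else 0) + \<alpha>"
    if "i < n" "j < n" for i j
  proof -
    have "(\<Sum>k<n. S $$ (k, i) * S $$ (k, j)) = col S i \<bullet> col S j"
      using Sc that by (simp add: scalar_prod_def lessThan_atLeast0)
    also have "\<dots> = (if i = j then 1 - \<alpha> else 0) + \<alpha>"
      using S that by (simp add: equiangular_mats_def)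
    finally show ?thesis .
  qed
  \<comment> \<open>The identity is proved in the complex numbers, where a squared modulus factors
    as \<open>z * cnj z\<close>; the real entries of \<open>S\<close> are fixed by
    \<open>cnj\<close>.\<close>
  have "complex_of_real (\<Sum>k<n. (cmod ((map_mat complex_of_real S *\<^sub>v x) $ k))\<^sup>2)
      = (\<Sum>k<n. (\<Sum>i<n. of_real (S $$ (k, i)) * x $ i) * cnj (\<Sum>j<n. of_real (S $$ (k, j)) * x $ j))"
    unfolding of_real_sum complex_norm_square using Sc x
    by (intro sum.cong) (auto simp: scalar_prod_def lessThan_atLeast0)
  also have "\<dots> = (\<Sum>k<n. \<Sum>i<n. \<Sum>j<n. of_real (S $$ (k, i) * S $$ (k, j)) * (x $ i * cnj (x $ j)))"
    by (simp add: sum_product mult_ac)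
  \<comment> \<open>With the row index \<open>k\<close> innermost, the inner sum is a Gram
    entry.\<close>
  also have "\<dots> = (\<Sum>i<n. \<Sum>j<n. \<Sum>k<n. of_real (S $$ (k, i) * S $$ (k, j)) * (x $ i * cnj (x $ j)))"
    by (subst sum.swap) (intro sum.cong refl sum.swap)
  also have "\<dots> = (\<Sum>i<n. \<Sum>j<n.
      of_real (\<Sum>k<n. S $$ (k, i) * S $$ (k, j)) * (x $ i * cnj (x $ j)))"
    by (simp add: sum_distrib_right)
  also have "\<dots> = (\<Sum>i<n. \<Sum>j<n. (if i = j then of_real (1 - \<alpha>) * (x $ i * cnj (x $ j)) else 0)
      + of_real \<alpha> * (x $ i * cnj (x $ j)))"
    by (intro sum.cong refl) (simp add: gram algebra_simps)
  also have "\<dots> = of_real (1 - \<alpha>) * (\<Sum>i<n. x $ i * cnj (x $ i))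
      + of_real \<alpha> * ((\<Sum>i<n. x $ i) * cnj (\<Sum>j<n. x $ j))"
    by (simp add: sum.distrib sum_product flip: sum_distrib_left)
  also have "\<dots> = of_real ((1 - \<alpha>) * (\<Sum>i<n. (cmod (x $ i))\<^sup>2) + \<alpha> * (cmod (\<Sum>i<n. x $ i))\<^sup>2)"
    by (simp only: of_real_add of_real_mult of_real_sum complex_norm_square)
  finally show ?thesis
    by (simp only: of_real_eq_iff)
qed

theorem theorem2p15:
  fixes n :: nat and \<alpha> :: real and S :: "real mat" and lam :: complex and x :: "complex vec"
  assumes "n \<ge> 2"
    and "\<alpha> \<in> {-1 / (real n - 1)<..<1}"
    and "S \<in> equiangular_mats n \<alpha>"
    and "eigenvector (map_mat complex_of_real S) x lam"
    and "euclidean_norm_vec x = 1"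
  shows "min_eigenvalue (equiangular_sqrt n \<alpha>) \<le> cmod lam
    \<and> cmod lam \<le> max_eigenvalue (equiangular_sqrt n \<alpha>)"
proof -
  have S: "S \<in> carrier_mat n n"
    using assms(3) by (simp add: equiangular_mats_def)
  have x: "x \<in> carrier_vec n" and ev: "map_mat complex_of_real S *\<^sub>v x = lam \<cdot>\<^sub>v x"
    using assms(4) S by (auto simp: eigenvector_def)
  have norm_x: "(\<Sum>i<n. (cmod (x $ i))\<^sup>2) = 1"
    using assms(5) x by (simp add: euclidean_norm_vec_def L2_set_def lessThan_atLeast0)
  define q where "q = (cmod (\<Sum>i<n. x $ i))\<^sup>2"
  \<comment> \<open>The triangle inequality passes to moduli, to which the real Cauchy-Schwarz bound
    applies.\<close>
  have "q \<le> (\<Sum>i<n. cmod (x $ i))\<^sup>2"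
    unfolding q_def by (intro power_mono norm_sum) simp
  also have "\<dots> \<le> real n"
    using power2_sum_le_card_mult_sum_power2[of "\<lambda>i. cmod (x $ i)" "{..<n}"] norm_x by simp
  finally have q: "0 \<le> q" "q \<le> real n"
    by (simp_all add: q_def)
  have "(\<Sum>k<n. (cmod ((lam \<cdot>\<^sub>v x) $ k))\<^sup>2) = (cmod lam)\<^sup>2 * (\<Sum>k<n. (cmod (x $ k))\<^sup>2)"
    using x by (simp add: norm_mult power_mult_distrib sum_distrib_left)
  then have lam: "(cmod lam)\<^sup>2 = 1 - \<alpha> + \<alpha> * q"
    using equiangular_mats_sum_cmod_power2[OF assms(3) x] by (simp add: ev norm_x q_def)
  \<comment> \<open>The lower bound on \<open>\<alpha>\<close> says exactly that
    \<open>1 + (n - 1) * \<alpha>\<close> is positive.\<close>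
  have pos: "1 - \<alpha> > 0" "1 - \<alpha> + real n * \<alpha> > 0"
    using assms(1,2) by (auto simp: field_simps)
  define a c where "a = sqrt (1 - \<alpha>)" and "c = sqrt (1 - \<alpha> + real n * \<alpha>)"
  \<comment> \<open>The sign of \<open>\<alpha>\<close> decides which of \<open>a\<close> and
    \<open>c\<close> is larger, since \<open>\<alpha> * q\<close> lies between 0 and
    \<open>n * \<alpha>\<close> in either order. The disjunction covers both orders when
    \<open>Min\<close> and \<open>Max\<close> are evaluated.\<close>
  have "a \<le> cmod lam \<and> cmod lam \<le> c \<or> c \<le> cmod lam \<and> cmod lam \<le> a"
  proof (cases "\<alpha> \<ge> 0")
    case True
    then have "0 \<le> \<alpha> * q" "\<alpha> * q \<le> real n * \<alpha>"
      using q by (simp_all add: mult_left_mono mult.commute)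
    then have "a \<le> cmod lam" "cmod lam \<le> c"
      unfolding a_def c_def using lam by (auto intro: real_le_lsqrt real_le_rsqrt)
    then show ?thesis
      by simp
  next
    case False
    then have "\<alpha> * q \<le> 0" "real n * \<alpha> \<le> \<alpha> * q"
      using q by (simp_all add: mult_nonpos_nonneg mult.commute)
    then have "c \<le> cmod lam" "cmod lam \<le> a"
      unfolding a_def c_def using lam by (auto intro: real_le_lsqrt real_le_rsqrt)
    then show ?thesis
      by simp
  qed
  then show ?thesis
    unfolding min_eigenvalue_def max_eigenvalue_def spectrum_equiangular_sqrt[OF assms(1) pos]
    by (auto simp: a_def c_def)
qed

end
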